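(* For each $i=1,\dots,n$, let $A_i\subset\mathbb{R}^n$ be a compact convex set whose interior is non-empty. Assume that, for every $i=1,\dots,n$, every boundary point $x$ of $A_i$ and every supporting hyperplane $H$ of $A_i$ at $x$, the set $A_i\cap H$ is a singleton. For each $i=1,\dots,n$ let $Q_i$ be a non-singular real matrix of order $n$, and put $f_i(x,\mathbf{u})=\langle u,Q_ix\rangle$ for $x\in\mathbb{R}^n$ and $\mathbf{u}=(u,u_{n+1})\in S^n$. Then there exists some $\mathbf{u}\in S^n$ such that for all $i=1,\dots,n$ both $A_i\cap H_{\mathbf{u}}^+$ and $A_i\cap H_{\mathbf{u}}^-$ are non-empty, and $$\max_{x\in A_i\cap H_{\mathbf{u}}^+}f_i(x,\mathbf{u})-\min_{x\in A_i\cap H_{\mathbf{u}}^+}f_i(x,\mathbf{u})=\max_{x\in A_i\cap H_{\mathbf{u}}^-}f_i(x,\mathbf{u})-\min_{x\in A_i\cap H_{\mathbf{u}}^-}f_i(x,\mathbf{u}).$$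
   Context: $S^n$ is the unit sphere in $\mathbb{R}^{n+1}$. A point $\mathbf{u}=(u_1,\dots,u_n,u_{n+1})\in S^n$ is written $\mathbf{u}=(u,u_{n+1})$ with $u=(u_1,\dots,u_n)\in\mathbb{R}^n$, and $H_{\mathbf{u}}^+=\{x\in\mathbb{R}^n\mid\langle u,x\rangle\ge u_{n+1}\}$, $H_{\mathbf{u}}^-=\{x\in\mathbb{R}^n\mid\langle u,x\rangle\le u_{n+1}\}$, where $\langle\cdot,\cdot\rangle$ is the standard inner product of $\mathbb{R}^n$. (If $u=0$, one of these two sets is $\mathbb{R}^n$ and the other is empty.) *)

theory Defs
  imports "HOL-Analysis.Analysis"
begin

text \<open>
  The space containing \<open>S\<^sup>n\<close> is the product \<open>(real ^ 'n) \<times> real\<close> with \<open>n = CARD('n)\<close>; its norm is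
  the Euclidean norm \<open>sqrt ((norm u)\<^sup>2 + t\<^sup>2)\<close>, so \<open>sphere 0 1\<close> in it is the unit sphere
  of \<open>(n + 1)\<close>-dimensional Euclidean space, with points split as \<open>(u, t)\<close>, \<open>t\<close> being the last coordinate.
\<close>

definition halfspace_pos :: "(real ^ 'n) \<times> real \<Rightarrow> (real ^ 'n) set" where
  "halfspace_pos v = {x. fst v \<bullet> x \<ge> snd v}"

definition halfspace_neg :: "(real ^ 'n) \<times> real \<Rightarrow> (real ^ 'n) set" where
  "halfspace_neg v = {x. fst v \<bullet> x \<le> snd v}"

text \<open>
  Requiring \<open>A\<close> to lie on the side \<open>a \<bullet> y \<le> b\<close> is no restriction, as \<open>(a, b)\<close> and
  \<open>(- a, - b)\<close> describe the same hyperplane.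
\<close>

definition supporting_hyperplane :: "('a::real_inner) set \<Rightarrow> 'a \<Rightarrow> 'a set \<Rightarrow> bool" where
  "supporting_hyperplane A x H \<longleftrightarrow>
     (\<exists>a b. a \<noteq> 0 \<and> H = {y. a \<bullet> y = b} \<and> x \<in> H \<and> A \<subseteq> {y. a \<bullet> y \<le> b})"

text \<open>
  These are unspecified when the extremum is not attained; the lemmas below exclude this for
  continuous functions on non-empty compact sets.
\<close>

definition max_over :: "'a set \<Rightarrow> ('a \<Rightarrow> real) \<Rightarrow> real" where
  "max_over S f = (GREATEST y. y \<in> f ` S)"

definition min_over :: "'a set \<Rightarrow> ('a \<Rightarrow> real) \<Rightarrow> real" where
  "min_over S f = (LEAST y. y \<in> f ` S)"

lemma max_over_attained:
  fixes S :: "'a::topological_space set"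
  assumes "compact S" "S \<noteq> {}" "continuous_on S f"
  shows "max_over S f \<in> f ` S" "\<And>x. x \<in> S \<Longrightarrow> f x \<le> max_over S f"
proof -
  obtain z where z: "z \<in> S" "\<forall>x\<in>S. f x \<le> f z"
    using continuous_attains_sup[OF assms] by blast
  have "max_over S f = f z"
    unfolding max_over_def by (rule Greatest_equality) (use z in auto)
  then show "max_over S f \<in> f ` S" "\<And>x. x \<in> S \<Longrightarrow> f x \<le> max_over S f"
    using z by auto
qed

lemma min_over_attained:
  fixes S :: "'a::topological_space set"
  assumes "compact S" "S \<noteq> {}" "continuous_on S f"
  shows "min_over S f \<in> f ` S" "\<And>x. x \<in> S \<Longrightarrow> min_over S f \<le> f x"
proof -
  obtain z where z: "z \<in> S" "\<forall>x\<in>S. f z \<le> f x"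
    using continuous_attains_inf[OF assms] by blast
  have "min_over S f = f z"
    unfolding min_over_def by (rule Least_equality) (use z in auto)
  then show "min_over S f \<in> f ` S" "\<And>x. x \<in> S \<Longrightarrow> min_over S f \<le> f x"
    using z by auto
qed

end

theory Submission
  imports Defs "HOL-Homology.Invariance_of_Domain"
begin

text \<open>
  For \<open>v = (u, t)\<close> on the sphere let \<open>W i v\<close> be the oscillation (maximum minus minimum) of
  \<open>f i\<close> on the cap of \<open>A i\<close> cut off by the positive half-space of \<open>v\<close>, and \<open>0\<close> if that cap is
  empty. The negative half-space of \<open>v\<close> is the positive one of \<open>- v\<close>, and replacing \<open>v\<close> by \<open>- v\<close>
  only changes the sign of \<open>f i\<close>. So the claimed equality says that the odd map
  \<open>v \<mapsto> (W i v - W i (- v))\<^sub>i\<close> from the \<open>n\<close>-sphere to \<open>n\<close>-space vanishes at \<open>v\<close>. Three things have to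
  be supplied.

  Continuity (\<open>continuous_on_spread_cap\<close>). The oscillation could jump only when the hyperplane
  becomes tangent and the cap suddenly disappears. By the hypothesis on supporting hyperplanes the
  cap is then a single point, where the oscillation is \<open>0\<close> anyway.

  Trivial zeros. At \<open>v = (0, \<plusminus>1)\<close> all \<open>f i\<close> are constant, so both oscillations are \<open>0\<close> although one of
  the half-spaces is empty. If the \<open>A i\<close> lie in a ball of radius \<open>R\<close> about the origin, then for
  \<open>t > R * norm u\<close> the positive half-space of \<open>v\<close> misses all of them, so \<open>W i v - W i (- v) \<le> 0\<close>
  there. Subtracting the odd continuous function \<open>t * max 0 (\<bar>t\<bar> - R * norm u)\<close> makes the
  difference negative in this region, positive in the opposite one, and leaves it alone elsewhere.
  At a remaining zero \<open>u \<noteq> 0\<close>, hence \<open>f i\<close> is not constant on \<open>A i\<close> (\<open>spread_pos\<close>), and an empty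
  cap on one side would mean oscillation zero there and a positive oscillation on the other side.

  The Borsuk--Ulam theorem (\<open>Borsuk_Ulam\<close>). The tool is \<open>Borsuk_odd_mapping_degree_step\<close>: an odd
  self-map of a sphere that preserves the equator has the same degree modulo 2 as its restriction to
  the equator. By Stone--Weierstrass it suffices to treat odd polynomial maps. An odd polynomial
  map without zeros on a sphere can be deformed, as an odd polynomial map without zeros, to one that
  preserves the equator, because the image of the equator is too small to meet all lines. So induction
  on the dimension shows that every odd polynomial self-map of a sphere has odd degree
  (\<open>odd_degree_polynomial\<close>). An odd map from the \<open>n\<close>-sphere to \<open>n\<close>-space without zeros would
  give an odd map from the \<open>n\<close>-sphere into its equator. It is not surjective, so its degree is \<open>0\<close>,
  while its restriction to the equator has odd degree.
\<close>

section \<open>Coordinate subspaces and spheres of lower dimension\<close>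

text \<open>
  The spheres \<open>nsphere m\<close> consist of sequences \<open>nat \<Rightarrow> real\<close> that vanish after index \<open>m\<close>,
  so that \<open>m\<close> can be an induction variable. Polynomials and null sets need a Euclidean type instead.
  Enumerating the coordinates of one fixed type \<open>real ^ 'n\<close> makes all \<open>nsphere m\<close> with \<open>m < CARD('n)\<close> unit
  spheres of coordinate subspaces of that type.
\<close>

definition coord_enum :: "nat \<Rightarrow> 'n::finite"
  where "coord_enum = (SOME b. bij_betw b {..<CARD('n)} UNIV)"

definition coord_index :: "'n::finite \<Rightarrow> nat"
  where "coord_index = the_inv_into {..<CARD('n)} coord_enum"

definition to_seq :: "real ^ 'n \<Rightarrow> nat \<Rightarrow> real"
  where "to_seq x = (\<lambda>i. if i < CARD('n) then x $ coord_enum i else 0)"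

definition of_seq :: "(nat \<Rightarrow> real) \<Rightarrow> real ^ 'n"
  where "of_seq y = (\<chi> j. y (coord_index j))"

definition coord_subspace :: "nat \<Rightarrow> (real ^ 'n) set"
  where "coord_subspace k = {x. \<forall>i\<ge>k. to_seq x i = 0}"

lemma bij_coord_enum: "bij_betw (coord_enum :: nat \<Rightarrow> 'n::finite) {..<CARD('n)} UNIV"
proof -
  have "\<exists>b. bij_betw b {..<CARD('n)} (UNIV :: 'n set)"
    using ex_bij_betw_nat_finite[of "UNIV :: 'n set"] by (simp add: atLeast0LessThan)
  then show ?thesis
    unfolding coord_enum_def by (rule someI_ex)
qed

lemma coord_index_enum [simp]: "i < CARD('n) \<Longrightarrow> coord_index (coord_enum i :: 'n::finite) = i"
  unfolding coord_index_def using bij_coord_enum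
  by (metis bij_betw_imp_inj_on lessThan_iff the_inv_into_f_f)

lemma coord_enum_index [simp]: "coord_enum (coord_index j) = (j :: 'n::finite)"
  unfolding coord_index_def using bij_coord_enum
  by (metis UNIV_I bij_betw_def f_the_inv_into_f)

lemma coord_index_less [simp]: "coord_index (j :: 'n::finite) < CARD('n)"
  unfolding coord_index_def using bij_coord_enum[where 'n='n]
  by (metis UNIV_I bij_betw_def lessThan_iff order_refl the_inv_into_into)

lemma of_seq_to_seq [simp]: "of_seq (to_seq x) = x"
  by (simp add: of_seq_def to_seq_def vec_eq_iff)

lemma to_seq_of_seq: "to_seq (of_seq y :: real ^ 'n) = (\<lambda>i. if i < CARD('n) then y i else 0)"
  by (auto simp: of_seq_def to_seq_def)

lemma to_seq_of_seq_id:
  assumes "\<And>i. i \<ge> CARD('n) \<Longrightarrow> y i = 0"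
  shows "to_seq (of_seq y :: real ^ 'n) = y"
  using assms by (auto simp: to_seq_of_seq)

lemma bounded_linear_to_seq [simp]: "bounded_linear (\<lambda>x. to_seq x i)"
  by (cases "i < CARD('a)") (auto simp: to_seq_def bounded_linear_vec_nth)

lemma to_seq_minus [simp]: "to_seq (- x) i = - to_seq x i"
  and to_seq_add [simp]: "to_seq (x + y) i = to_seq x i + to_seq y i"
  and to_seq_diff [simp]: "to_seq (x - y) i = to_seq x i - to_seq y i"
  and to_seq_scaleR [simp]: "to_seq (c *\<^sub>R x) i = c * to_seq x i"
  and to_seq_zero [simp]: "to_seq 0 i = 0"
  by (auto simp: to_seq_def)

lemma of_seq_minus [simp]: "of_seq (\<lambda>i. - y i) = - of_seq y"
  by (simp add: of_seq_def vec_eq_iff)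

lemma to_seq_eqI: "(\<And>i. to_seq x i = to_seq y i) \<Longrightarrow> x = y"
  by (metis ext of_seq_to_seq)

lemma norm_eq_to_seq: "(norm (x :: real ^ 'n))\<^sup>2 = (\<Sum>i<CARD('n). (to_seq x i)\<^sup>2)"
proof -
  have "(norm x)\<^sup>2 = (\<Sum>j\<in>UNIV. (x $ j)\<^sup>2)"
    by (simp add: norm_vec_def L2_set_def sum_nonneg)
  also have "\<dots> = (\<Sum>i<CARD('n). (x $ coord_enum i)\<^sup>2)"
    by (rule sum.reindex_bij_betw [OF bij_coord_enum, symmetric])
  finally show ?thesis
    by (simp add: to_seq_def)
qed

lemma norm_coord_subspace:
  assumes "x \<in> coord_subspace k"
  shows "(norm (x :: real ^ 'n))\<^sup>2 = (\<Sum>i<k. (to_seq x i)\<^sup>2)"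
proof -
  have "(norm x)\<^sup>2 = (\<Sum>i<max k CARD('n). (to_seq x i)\<^sup>2)"
    unfolding norm_eq_to_seq by (rule sum.mono_neutral_left) (auto simp: to_seq_def)
  also have "\<dots> = (\<Sum>i<k. (to_seq x i)\<^sup>2)"
    using assms by (intro sum.mono_neutral_right) (auto simp: coord_subspace_def)
  finally show ?thesis .
qed

lemma subspace_coord_subspace: "subspace (coord_subspace k)"
  by (auto simp: subspace_def coord_subspace_def)

lemma coord_subspace_mono: "k \<le> l \<Longrightarrow> coord_subspace k \<subseteq> coord_subspace l"
  by (auto simp: coord_subspace_def)

lemma coord_subspace_full: "coord_subspace CARD('n) = (UNIV :: (real ^ 'n) set)"
  by (auto simp: coord_subspace_def to_seq_def)

lemma nsphere_eq_to_seq: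
  assumes "m < CARD('n)"
  shows "topspace (nsphere m) = to_seq ` (sphere (0 :: real ^ 'n) 1 \<inter> coord_subspace (Suc m))"
proof (intro equalityI subsetI)
  fix y assume "y \<in> topspace (nsphere m)"
  then have y: "(\<Sum>i\<le>m. (y i)\<^sup>2) = 1" "\<And>i. i > m \<Longrightarrow> y i = 0"
    by (auto simp: nsphere)
  then have eq: "to_seq (of_seq y :: real ^ 'n) = y"
    using assms by (intro to_seq_of_seq_id) auto
  moreover have sub: "(of_seq y :: real ^ 'n) \<in> coord_subspace (Suc m)"
    using y(2) by (simp add: coord_subspace_def eq)
  moreover have "norm (of_seq y :: real ^ 'n) = 1"
    using norm_coord_subspace[OF sub] y(1)
    by (simp add: eq lessThan_Suc_atMost power2_eq_1_iff) (metis norm_ge_zero not_one_le_zero neg_0_le_iff_le)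
  ultimately show "y \<in> to_seq ` (sphere (0 :: real ^ 'n) 1 \<inter> coord_subspace (Suc m))"
    by (intro image_eqI[of _ _ "of_seq y"]) auto
next
  fix y assume "y \<in> to_seq ` (sphere (0 :: real ^ 'n) 1 \<inter> coord_subspace (Suc m))"
  then obtain x :: "real ^ 'n" where "y = to_seq x" "norm x = 1" "x \<in> coord_subspace (Suc m)"
    by auto
  then show "y \<in> topspace (nsphere m)"
    using norm_coord_subspace[of x "Suc m"]
    by (auto simp: nsphere coord_subspace_def lessThan_Suc_atMost)
qed

lemma continuous_map_nsphere_iff:
  "continuous_map X (nsphere m) f \<longleftrightarrow>
     (\<forall>i. continuous_map X euclideanreal (\<lambda>x. f x i)) \<and> f \<in> topspace X \<rightarrow> topspace (nsphere m)"
  by (auto simp: nsphere continuous_map_in_subtopology continuous_map_componentwise_UNIV Pi_iff)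

lemma continuous_map_of_seq:
  "continuous_map (nsphere m) euclidean (of_seq :: _ \<Rightarrow> real ^ 'n)"
proof -
  have "continuous_on UNIV (of_seq :: _ \<Rightarrow> real ^ 'n)"
    unfolding of_seq_def by (intro continuous_intros continuous_on_product_coordinates)
  then show ?thesis
    by (auto simp: nsphere euclidean_product_topology intro: continuous_on_subset)
qed

definition coord_sphere :: "nat \<Rightarrow> (real ^ 'n) set"
  where "coord_sphere m = sphere 0 1 \<inter> coord_subspace (Suc m)"

definition sphere_map :: "(real ^ 'n \<Rightarrow> real ^ 'n) \<Rightarrow> (nat \<Rightarrow> real) \<Rightarrow> nat \<Rightarrow> real"
  where "sphere_map f y = to_seq (sgn (f (of_seq y)))"

lemma of_seq_coord_sphere:
  assumes "m < CARD('n)" "y \<in> topspace (nsphere m)"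
  shows "(of_seq y :: real ^ 'n) \<in> coord_sphere m" "to_seq (of_seq y :: real ^ 'n) = y"
  using assms by (auto simp: nsphere_eq_to_seq coord_sphere_def)

lemma to_seq_sgn_in_nsphere:
  assumes "m < CARD('n)" "(z :: real ^ 'n) \<noteq> 0" "z \<in> coord_subspace (Suc m)"
  shows "to_seq (sgn z) \<in> topspace (nsphere m)"
  using assms subspace_scale[OF subspace_coord_subspace, of z "Suc m" "inverse (norm z)"]
  by (auto simp: nsphere_eq_to_seq norm_sgn sgn_div_norm[of z] intro!: imageI)

text \<open>
  Normalizing a homotopy without zeros. The homotopy is a function of pairs, so that continuity is
  the ordinary continuity on a subset of a product of Euclidean spaces.
\<close>

lemma homotopic_sphere_maps:
  fixes h :: "real \<times> (real ^ 'n) \<Rightarrow> real ^ 'n"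
  assumes m: "m < CARD('n)"
    and cont: "continuous_on ({0..1} \<times> coord_sphere m) h"
    and nz: "\<And>t x. t \<in> {0..1} \<Longrightarrow> x \<in> coord_sphere m \<Longrightarrow> h (t, x) \<noteq> 0"
    and sub: "\<And>t x. t \<in> {0..1} \<Longrightarrow> x \<in> coord_sphere m \<Longrightarrow> h (t, x) \<in> coord_subspace (Suc m)"
  shows "homotopic_with (\<lambda>_. True) (nsphere m) (nsphere m)
           (sphere_map (\<lambda>x. h (0, x))) (sphere_map (\<lambda>x. h (1, x)))"
proof -
  let ?X = "prod_topology (top_of_set {0..1::real}) (nsphere m)"
  let ?H = "\<lambda>z. to_seq (sgn (h (fst z, of_seq (snd z))))"
  have pair: "continuous_map ?X (top_of_set ({0..1} \<times> coord_sphere m))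
      (\<lambda>z. (fst z, of_seq (snd z) :: real ^ 'n))"
  proof -
    have "continuous_map ?X (prod_topology euclidean euclidean) (\<lambda>z. (fst z, of_seq (snd z) :: real ^ 'n))"
      using continuous_map_compose[OF continuous_map_snd continuous_map_of_seq]
        continuous_map_into_fulltopology[OF continuous_map_fst]
      by (auto simp only: continuous_map_pairwise o_def fst_conv snd_conv)
    then show ?thesis
      using m by (auto simp: continuous_map_in_subtopology of_seq_coord_sphere)
  qed
  have *: "continuous_map (top_of_set ({0..1} \<times> coord_sphere m)) euclideanreal (\<lambda>z. to_seq (sgn (h z)) i)" for i
    using nz bounded_linear.continuous_on[OF bounded_linear_to_seq continuous_on_sgn[OF cont]] by auto
  have "continuous_map ?X (nsphere m) ?H"
    using continuous_map_compose[OF pair *] nz sub m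
    by (auto simp: continuous_map_nsphere_iff o_def of_seq_coord_sphere intro!: to_seq_sgn_in_nsphere)
  then show ?thesis
    unfolding homotopic_with_def
    by (intro exI[of _ ?H]) (auto simp: sphere_map_def)
qed

lemma continuous_map_sphere_map:
  fixes f :: "real ^ 'n \<Rightarrow> real ^ 'n"
  assumes "m < CARD('n)" "continuous_on (coord_sphere m) f"
    and "\<And>x. x \<in> coord_sphere m \<Longrightarrow> f x \<noteq> 0"
    and "\<And>x. x \<in> coord_sphere m \<Longrightarrow> f x \<in> coord_subspace (Suc m)"
  shows "continuous_map (nsphere m) (nsphere m) (sphere_map f)"
proof -
  have "continuous_on ({0..1} \<times> coord_sphere m) (\<lambda>z::real \<times> _. f (snd z))"
    by (rule continuous_on_compose2[OF assms(2)]) (auto intro: continuous_intros)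
  then show ?thesis
    using homotopic_with_imp_continuous_maps[OF homotopic_sphere_maps[of m "\<lambda>z. f (snd z)"]] assms
    by auto
qed

text \<open>
  Oddness in the form in which \<open>Borsuk_odd_mapping_degree_step\<close> expects it.
\<close>

lemma sphere_map_odd:
  assumes "f (- of_seq u) = - f (of_seq u)"
  shows "(sphere_map f \<circ> (\<lambda>x i. - x i)) u = ((\<lambda>x i. - x i) \<circ> sphere_map f) u"
  using assms by (auto simp: sphere_map_def sgn_minus)

section \<open>Odd polynomial maps of spheres have odd degree\<close>

definition coord_proj :: "nat \<Rightarrow> real ^ 'n \<Rightarrow> real ^ 'n"
  where "coord_proj k x = (\<chi> j. if coord_index j < k then x $ j else 0)"

lemma to_seq_coord_proj [simp]: "to_seq (coord_proj k x) i = (if i < k then to_seq x i else 0)"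
  by (auto simp: to_seq_def coord_proj_def)

lemma bounded_linear_coord_proj: "bounded_linear (coord_proj k)"
  unfolding linear_conv_bounded_linear[symmetric]
  by (intro linearI to_seq_eqI) auto

text \<open>
  The cylinder lies in the boundary of a convex set: stretching a point of it by any factor above 1
  leads out of the solid cylinder.
\<close>

lemma negligible_cylinder: "negligible {x :: real ^ 'n. norm (coord_proj k x) = 1}"
proof (rule negligible_subset)
  let ?C = "{x :: real ^ 'n. norm (coord_proj k x) \<le> 1}"
  have lin: "linear (coord_proj k :: real ^ 'n \<Rightarrow> _)"
    using bounded_linear_coord_proj by (rule bounded_linear.linear)
  have "?C = coord_proj k -` cball 0 1"
    by auto
  then show "negligible (frontier ?C)"
    using convex_linear_vimage[OF lin convex_cball] by (metis negligible_convex_frontier)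
  show "{x. norm (coord_proj k x) = 1} \<subseteq> frontier ?C"
  proof
    fix x :: "real ^ 'n" assume x: "x \<in> {x. norm (coord_proj k x) = 1}"
    have "x \<notin> interior ?C"
    proof
      assume "x \<in> interior ?C"
      then obtain e where e: "e > 0" "ball x e \<subseteq> ?C"
        by (auto simp: mem_interior)
      define d where "d = e / (2 * (norm x + 1))"
      have d: "d > 0"
        using e by (simp add: d_def add_nonneg_pos)
      have "d * norm x < e"
        using e by (simp add: d_def field_simps add_pos_nonneg) (smt (verit) mult_nonneg_nonneg norm_ge_zero)
      then have "x + d *\<^sub>R x \<in> ball x e"
        using d by (simp add: dist_norm)
      then have "norm (coord_proj k (x + d *\<^sub>R x)) \<le> 1"
        using e by blast
      moreover have "coord_proj k (x + d *\<^sub>R x) = (1 + d) *\<^sub>R coord_proj k x"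
        by (simp add: linear_add[OF lin] linear_scale[OF lin] scaleR_add_left)
      ultimately show False
        using x d by simp
    qed
    moreover have "x \<in> closure ?C"
      using x closure_subset[of ?C] by auto
    ultimately show "x \<in> frontier ?C"
      by (simp add: frontier_def)
  qed
qed

text \<open>
  The lines through the points \<open>f x\<close>, with \<open>x\<close> on the unit sphere of an \<open>m\<close>-dimensional space, fill
  only an \<open>m\<close>-dimensional part of an \<open>(m + 1)\<close>-dimensional space. To express this by null sets of
  the full space \<open>real ^ 'n\<close>, the factor \<open>t\<close> is stored in coordinate \<open>m\<close> and all further
  coordinates are carried along unchanged. The union of the lines, times the space of the further
  coordinates, is then the image of a cylinder under a polynomial map \<open>F\<close>, hence a null set. The
  hyperplane where coordinate \<open>m\<close> vanishes is a null set as well, so some point lies in neither.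
\<close>

lemma avoided_direction:
  fixes f :: "real ^ 'n \<Rightarrow> real ^ 'n"
  assumes m: "m < CARD('n)" and poly: "polynomial_function f"
    and sub: "\<And>x. x \<in> coord_subspace m \<Longrightarrow> f x \<in> coord_subspace (Suc m)"
  obtains p where "p \<in> coord_subspace (Suc m)" "to_seq p m \<noteq> 0"
    "\<And>t x. x \<in> coord_subspace m \<Longrightarrow> norm x = 1 \<Longrightarrow> t *\<^sub>R f x \<noteq> p"
proof -
  let ?S = "{x :: real ^ 'n. norm (coord_proj m x) = 1}"
  let ?T = "{x :: real ^ 'n. to_seq x m = 0}"
  define F where "F = (\<lambda>x. to_seq x m *\<^sub>R f (coord_proj m x) + (x - coord_proj (Suc m) x))"
  define e :: "real ^ 'n" where "e = of_seq (\<lambda>i. if i = m then 1 else 0)"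
  have e: "to_seq e i = (if i = m then 1 else 0)" for i
    using m by (auto simp: e_def to_seq_of_seq)
  have "polynomial_function F"
    unfolding F_def
    using polynomial_function_compose[OF polynomial_function_bounded_linear[OF bounded_linear_coord_proj] poly,
        of m, unfolded o_def]
    by (intro polynomial_function_add polynomial_function_mult polynomial_function_diff
        polynomial_function_bounded_linear[OF bounded_linear_coord_proj]
        polynomial_function_bounded_linear[OF bounded_linear_to_seq] polynomial_function_id)
  then have "negligible (F ` ?S)"
    by (intro negligible_differentiable_image_negligible negligible_cylinder
        differentiable_on_polynomial_function) auto
  moreover have "negligible ?T"
  proof -
    have "to_seq x m = axis (coord_enum m) 1 \<bullet> x" for x :: "real ^ 'n"
      using m by (simp add: to_seq_def inner_axis' )
    then show ?thesis
      using negligible_hyperplane[of "axis (coord_enum m) 1 :: real ^ 'n" 0] by (simp add: axis_eq_0_iff)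
  qed
  ultimately have "negligible (F ` ?S \<union> ?T)"
    by (rule negligible_Un)
  then obtain y where y: "y \<notin> F ` ?S" "to_seq y m \<noteq> 0"
    using non_negligible_UNIV by (metis (mono_tags, lifting) UNIV_eq_I UnCI mem_Collect_eq)
  show thesis
  proof (rule that[of "coord_proj (Suc m) y"])
    fix t and x :: "real ^ 'n"
    assume x: "x \<in> coord_subspace m" "norm x = 1"
    show "t *\<^sub>R f x \<noteq> coord_proj (Suc m) y"
    proof
      assume eq: "t *\<^sub>R f x = coord_proj (Suc m) y"
      define z where "z = x + t *\<^sub>R e + (y - coord_proj (Suc m) y)"
      have "coord_proj m z = x"
        using x by (intro to_seq_eqI) (auto simp: z_def e coord_subspace_def)
      moreover have "to_seq z m = t"
        using x by (auto simp: z_def e coord_subspace_def)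
      moreover have "z - coord_proj (Suc m) z = y - coord_proj (Suc m) y"
        using x by (intro to_seq_eqI) (auto simp: z_def e coord_subspace_def)
      ultimately have "F z = y" "z \<in> ?S"
        using x eq by (auto simp: F_def)
      then show False
        using y by blast
    qed
  qed (use y in \<open>auto simp: coord_subspace_def\<close>)
qed

text \<open>
  On a line \<open>f\<close> agrees on the two unit vectors with multiplication by a number, so the
  normalized map is either the identity or the reflection.
\<close>

lemma odd_degree_sphere_0:
  fixes f :: "real ^ 'n \<Rightarrow> real ^ 'n"
  assumes odd_f: "\<And>x. f (- x) = - f x"
    and sub: "\<And>x. x \<in> coord_sphere 0 \<Longrightarrow> f x \<in> coord_subspace (Suc 0)"
    and nz: "\<And>x. x \<in> coord_sphere 0 \<Longrightarrow> f x \<noteq> 0"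
  shows "odd (Brouwer_degree2 0 (sphere_map f))"
proof -
  define e :: "real ^ 'n" where "e = of_seq (\<lambda>i. if i = 0 then 1 else 0)"
  have e: "to_seq e i = (if i = 0 then 1 else 0)" for i
    by (auto simp: e_def to_seq_of_seq)
  have line: "x = to_seq x 0 *\<^sub>R e" if "x \<in> coord_subspace (Suc 0)" for x
    using that by (intro to_seq_eqI) (auto simp: e coord_subspace_def Suc_le_eq)
  have e_line: "e \<in> coord_subspace (Suc 0)"
    by (auto simp: e coord_subspace_def)
  have norm_e: "norm e = 1"
    using norm_coord_subspace[OF e_line] by (simp add: e power2_eq_1_iff) (metis norm_ge_zero not_one_le_zero neg_0_le_iff_le)
  then have e_sphere: "e \<in> coord_sphere 0"
    by (simp add: coord_sphere_def e_line)
  define c where "c = to_seq (f e) 0"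
  have fe: "f e = c *\<^sub>R e"
    unfolding c_def by (rule line[OF sub[OF e_sphere]])
  have "c \<noteq> 0"
    using nz[OF e_sphere] fe by auto
  have sphere_map: "sphere_map f y i = sgn c * y i" if "y \<in> topspace (nsphere 0)" for y i
  proof -
    define x :: "real ^ 'n" where "x = of_seq y"
    have x: "x \<in> coord_sphere 0" "to_seq x = y"
      unfolding x_def using that of_seq_coord_sphere[of 0 y] by auto
    then have "x = to_seq x 0 *\<^sub>R e" "norm x = 1"
      using line by (auto simp: coord_sphere_def)
    then have "x = e \<or> x = - e"
      using norm_e by (metis abs_eq_iff' abs_1 mult.right_neutral norm_scaleR scaleR_minus1_left scaleR_one)
    then have "f x = c *\<^sub>R x"
      using odd_f fe by auto
    then have "sgn (f x) = sgn c *\<^sub>R x"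
      using \<open>norm x = 1\<close> by (simp add: sgn_scaleR sgn_div_norm)
    then show ?thesis
      using x by (simp add: sphere_map_def x_def[symmetric])
  qed
  show ?thesis
  proof (cases "c > 0")
    case True
    then have "Brouwer_degree2 0 (sphere_map f) = Brouwer_degree2 0 id"
      by (intro Brouwer_degree2_eq) (auto simp: sphere_map fun_eq_iff)
    then show ?thesis
      by simp
  next
    case False
    with \<open>c \<noteq> 0\<close> have "Brouwer_degree2 0 (sphere_map f) = Brouwer_degree2 0 (\<lambda>x i. if i = 0 then - x i else x i)"
      by (intro Brouwer_degree2_eq) (auto simp: sphere_map fun_eq_iff nsphere)
    then show ?thesis
      by (simp add: Brouwer_degree2_reflection)
  qed
qed


text \<open>
  Let \<open>p\<close> be a vector that is transversal to the equator's subspace and lies on none of the lines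
  spanned by values of \<open>f\<close> on the equator. Subtract from \<open>f\<close> the
  multiple of \<open>p\<close> that cancels the last coordinate, weighted by \<open>t * (1 - s\<^sup>2)\<close>, where \<open>s\<close> is the
  last coordinate of the argument. The weight is a polynomial and equals \<open>t\<close> on the equator,
  so at \<open>t = 1\<close> the map preserves the equator's subspace. A zero could arise only where \<open>f x\<close> is
  a multiple of \<open>p\<close> and the weight is 1, thus only on the equator, where \<open>p\<close> is avoided.
\<close>

theorem odd_degree_polynomial:
  fixes f :: "real ^ 'n \<Rightarrow> real ^ 'n"
  assumes "m < CARD('n)" "polynomial_function f" "\<And>x. f (- x) = - f x"
    and "\<And>x. x \<in> coord_subspace (Suc m) \<Longrightarrow> f x \<in> coord_subspace (Suc m)"
    and "\<And>x. x \<in> coord_sphere m \<Longrightarrow> f x \<noteq> 0"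
  shows "odd (Brouwer_degree2 m (sphere_map f))"
  using assms
proof (induction m arbitrary: f)
  case 0
  then show ?case
    by (intro odd_degree_sphere_0) (auto simp: coord_sphere_def)
next
  case (Suc m)
  note poly = Suc.prems(2) and odd_f = Suc.prems(3) and sub = Suc.prems(4) and nz = Suc.prems(5)
  have "f x \<in> coord_subspace (Suc (Suc m))" if "x \<in> coord_subspace (Suc m)" for x
    using sub that coord_subspace_mono[of "Suc m" "Suc (Suc m)"] by auto
  then obtain p where p: "p \<in> coord_subspace (Suc (Suc m))" "to_seq p (Suc m) \<noteq> 0"
    and avoid: "\<And>t x. x \<in> coord_subspace (Suc m) \<Longrightarrow> norm x = 1 \<Longrightarrow> t *\<^sub>R f x \<noteq> p"
    using avoided_direction[OF Suc.prems(1) poly] by blast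
  define h where "h = (\<lambda>(t, x). f x -
    (t * (1 - (to_seq x (Suc m))\<^sup>2) * (to_seq (f x) (Suc m) / to_seq p (Suc m))) *\<^sub>R p)"
  have h0: "(\<lambda>x. h (0, x)) = f"
    by (simp add: h_def)
  have cont_f: "continuous_on S f" for S
    using poly by (rule continuous_on_polymonial_function)
  have cont_h: "continuous_on S h" for S
    unfolding h_def case_prod_unfold
    using continuous_on_compose2[OF cont_f[of UNIV] continuous_on_snd[OF continuous_on_id]]
      bounded_linear.continuous_on[OF bounded_linear_to_seq continuous_on_snd[OF continuous_on_id]]
      bounded_linear.continuous_on[OF bounded_linear_to_seq
        continuous_on_compose2[OF cont_f[of UNIV] continuous_on_snd[OF continuous_on_id]]]
    by (intro continuous_intros) (auto simp: p)
  have sub_h: "h (t, x) \<in> coord_subspace (Suc (Suc m))" if "x \<in> coord_subspace (Suc (Suc m))" for t x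
    unfolding h_def using subspace_coord_subspace p sub[OF that]
    by (auto intro!: subspace_diff subspace_scale)
  have nz_h: "h (t, x) \<noteq> 0" if t: "t \<in> {0..1}" and x: "x \<in> coord_sphere (Suc m)" for t x
  proof
    assume h: "h (t, x) = 0"
    (* s is the weight of the correction at x, and c * p is the full correction. *)
    define s where "s = t * (1 - (to_seq x (Suc m))\<^sup>2)"
    define c where "c = to_seq (f x) (Suc m) / to_seq p (Suc m)"
    have fx: "f x = (s * c) *\<^sub>R p"
      using h by (simp add: h_def s_def c_def)
    then have "to_seq (f x) (Suc m) = s * c * to_seq p (Suc m)"
      by (metis to_seq_scaleR)
    then have "c = s * c"
      using p by (simp add: c_def)
    moreover have "c \<noteq> 0"
      using fx nz[OF x] by auto
    ultimately have "s = 1"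
      by simp
    moreover have "s \<le> 1 - (to_seq x (Suc m))\<^sup>2"
    proof -
      have "(to_seq x (Suc m))\<^sup>2 \<le> 1"
        using norm_coord_subspace[of x "Suc (Suc m)"] x sum_nonneg[of "{..<Suc m}" "\<lambda>i. (to_seq x i)\<^sup>2"]
        by (simp add: coord_sphere_def)
      then show ?thesis
        using t unfolding s_def by (intro mult_left_le_one_le) auto
    qed
    ultimately have "to_seq x (Suc m) = 0"
      by (simp add: power2_less_eq_zero_iff)
    then have "x \<in> coord_subspace (Suc m)" "norm x = 1"
      using x by (auto simp: coord_sphere_def coord_subspace_def) (metis Suc_leI le_neq_implies_less)
    moreover have "(1 / c) *\<^sub>R f x = p"
      using fx \<open>c \<noteq> 0\<close> \<open>s = 1\<close> by simp
    ultimately show False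
      using avoid by blast
  qed
  define g where "g = (\<lambda>x. h (1, x))"
  have deg_eq: "Brouwer_degree2 (Suc m) (sphere_map f) = Brouwer_degree2 (Suc m) (sphere_map g)"
    using homotopic_sphere_maps[OF Suc.prems(1) cont_h nz_h] sub_h
    unfolding g_def by (intro Brouwer_degree2_homotopic) (auto simp: h0 coord_sphere_def)
  have odd_g: "g (- x) = - g x" for x
    by (simp add: g_def h_def odd_f)
  have sub_g: "g x \<in> coord_subspace (Suc m)" if "x \<in> coord_subspace (Suc m)" for x
  proof -
    have "x \<in> coord_subspace (Suc (Suc m))" "to_seq x (Suc m) = 0"
      using that by (auto simp: coord_subspace_def)
    then have "g x \<in> coord_subspace (Suc (Suc m))" "to_seq (g x) (Suc m) = 0"
      using sub_h p by (auto simp: g_def) (simp add: h_def)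
    then show ?thesis
      by (auto simp: coord_subspace_def) (metis Suc_leI le_neq_implies_less)
  qed
  have poly_g: "polynomial_function g"
  proof -
    have lin: "polynomial_function (\<lambda>x :: real ^ 'n. to_seq x (Suc m))"
      by (rule polynomial_function_bounded_linear) simp
    have a: "polynomial_function (\<lambda>x :: real ^ 'n. 1 - (to_seq x (Suc m))\<^sup>2)"
      unfolding real_polynomial_function_eq[symmetric]
      using lin by (intro real_polynomial_function_diff real_polynomial_function_power)
         (auto simp: real_polynomial_function_eq)
    have b: "polynomial_function (\<lambda>x. to_seq (f x) (Suc m) / to_seq p (Suc m))"
      unfolding real_polynomial_function_eq[symmetric]
      using polynomial_function_compose[OF poly lin]
      by (intro real_polynomial_function_divide) (simp add: real_polynomial_function_eq o_def)
    show ?thesis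
      using polynomial_function_diff[OF poly polynomial_function_mult[OF a
            polynomial_function_mult[OF b polynomial_function_const[of p]]]]
      by (simp add: g_def h_def)
  qed
  have sphere_sub: "coord_sphere m \<subseteq> (coord_sphere (Suc m) :: (real ^ 'n) set)"
    using coord_subspace_mono[of "Suc m" "Suc (Suc m)"] by (auto simp: coord_sphere_def)
  have cont_g: "continuous_on S g" for S
    using poly_g by (rule continuous_on_polymonial_function)
  have cm_g: "continuous_map (nsphere (Suc m)) (nsphere (Suc m)) (sphere_map g)"
    using Suc.prems(1) nz_h[of 1] sub_h
    by (intro continuous_map_sphere_map cont_g) (auto simp: g_def coord_sphere_def)
  have cm_g': "continuous_map (nsphere m) (nsphere m) (sphere_map g)"
    using Suc.prems(1) nz_h[of 1] sub_g sphere_sub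
    by (intro continuous_map_sphere_map cont_g) (auto simp: g_def coord_sphere_def)
  have "even (Brouwer_degree2 (Suc m) (sphere_map g) - Brouwer_degree2 m (sphere_map g))"
    using Borsuk_odd_mapping_degree_step[OF cm_g sphere_map_odd[of g]] odd_g
      continuous_map_funspace[OF cm_g'] by simp
  moreover have "odd (Brouwer_degree2 m (sphere_map g))"
    using Suc.prems(1) sphere_sub nz_h[of 1]
    by (intro Suc.IH poly_g odd_g sub_g) (auto simp: g_def)
  ultimately show ?case
    using deg_eq by simp
qed

section \<open>The Borsuk--Ulam theorem\<close>

text \<open>
  Without zeros, normalizing \<open>q\<close> gives an odd map \<open>G\<close> of the \<open>n\<close>-sphere into its
  equator. It has degree 0 because it misses the pole, but its restriction to the equator is
  the normalization of the odd polynomial map \<open>f\<close> and has odd degree.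
\<close>

lemma Borsuk_Ulam_polynomial:
  fixes q :: "(real ^ 'n) \<times> real \<Rightarrow> real ^ 'n"
  assumes poly: "polynomial_function q" and odd_q: "\<And>x. q (- x) = - q x"
  shows "\<exists>x \<in> sphere 0 1. q x = 0"
proof (rule ccontr)
  assume "\<not> ?thesis"
  then have nz: "q x \<noteq> 0" if "norm x = 1" for x
    using that by auto
  define n where "n = CARD('n)"
  have n: "n > 0"
    by (simp add: n_def)
  define f where "f = (\<lambda>x. q (x, 0))"
  define G where "G = (\<lambda>y. to_seq (sgn (q (of_seq y, y n))))"
  have norm_pair: "norm (of_seq y :: real ^ 'n, y n) = 1" if "y \<in> topspace (nsphere n)" for y
  proof -
    have "(norm (of_seq y :: real ^ 'n))\<^sup>2 = (\<Sum>i<n. (y i)\<^sup>2)"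
      by (simp add: norm_eq_to_seq to_seq_of_seq n_def)
    then have "(norm (of_seq y :: real ^ 'n, y n))\<^sup>2 = (\<Sum>i\<le>n. (y i)\<^sup>2)"
      by (simp add: norm_Pair lessThan_Suc_atMost[symmetric] sum_nonneg)
    then have "(norm (of_seq y :: real ^ 'n, y n))\<^sup>2 = 1\<^sup>2"
      using that by (auto simp: nsphere)
    then show ?thesis
      by (rule power2_eq_imp_eq) auto
  qed
  have pair: "continuous_map (nsphere n) (top_of_set (sphere 0 1)) (\<lambda>y. (of_seq y :: real ^ 'n, y n))"
  proof -
    have "continuous_map (nsphere n) (prod_topology euclidean euclidean) (\<lambda>y. (of_seq y :: real ^ 'n, y n))"
      using continuous_map_of_seq continuous_map_nsphere_projection
      by (auto simp only: continuous_map_pairwise o_def fst_conv snd_conv)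
    then show ?thesis
      using norm_pair by (auto simp: continuous_map_in_subtopology)
  qed
  have "continuous_on (sphere 0 1) (\<lambda>x. sgn (q x))"
    using nz by (intro continuous_on_sgn continuous_on_polymonial_function poly) auto
  then have *: "continuous_map (top_of_set (sphere 0 1)) euclideanreal (\<lambda>x. to_seq (sgn (q x)) i)" for i
    using bounded_linear.continuous_on[OF bounded_linear_to_seq] by auto
  have G_sub: "G y \<in> topspace (nsphere (n - 1))" if "y \<in> topspace (nsphere n)" for y
    unfolding G_def using nz[OF norm_pair[OF that]] n coord_subspace_full[where 'n='n]
    by (intro to_seq_sgn_in_nsphere) (auto simp: n_def)
  have nsphere_sub: "topspace (nsphere (n - 1)) = topspace (nsphere n) \<inter> {y. y n = 0}"
    using subtopology_nsphere_equator[of "n - 1"] n by (metis Suc_pred' topspace_subtopology)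
  have cm_G: "continuous_map (nsphere n) (nsphere n) G"
    using continuous_map_compose[OF pair *] G_sub nsphere_sub
    by (auto simp: continuous_map_nsphere_iff G_def o_def)
  have "(\<lambda>i. if i = n then 1 else 0) \<in> topspace (nsphere n) - G ` topspace (nsphere n)"
  proof -
    have "(\<Sum>i\<le>n. (if i = n then 1 else 0 :: real)\<^sup>2) = (\<Sum>i\<le>n. if i = n then 1 else 0)"
      by (rule sum.cong) auto
    then have "(\<lambda>i. if i = n then 1 else 0) \<in> topspace (nsphere n)"
      by (simp add: nsphere)
    then show ?thesis
      using G_sub nsphere_sub by (auto simp: fun_eq_iff) (metis zero_neq_one)
  qed
  then have "Brouwer_degree2 n G = 0"
    by (intro Brouwer_degree2_nonsurjective cm_G) auto
  moreover have "even (Brouwer_degree2 n G - Brouwer_degree2 (n - 1) G)"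
  proof -
    have "(G \<circ> (\<lambda>x i. - x i)) u = ((\<lambda>x i. - x i) \<circ> G) u" for u
      using odd_q[of "(of_seq u, u n)"] by (auto simp: G_def sgn_minus)
    then show ?thesis
      using Borsuk_odd_mapping_degree_step[OF cm_G] G_sub nsphere_sub by auto
  qed
  moreover have "odd (Brouwer_degree2 (n - 1) G)"
  proof -
    have "Brouwer_degree2 (n - 1) G = Brouwer_degree2 (n - 1) (sphere_map f)"
      using nsphere_sub by (intro Brouwer_degree2_eq) (auto simp: G_def sphere_map_def f_def)
    moreover have "polynomial_function (\<lambda>x :: real ^ 'n. (x, 0 :: real))"
      by (intro polynomial_function_bounded_linear bounded_linear_Pair bounded_linear_ident bounded_linear_zero)
    then have "polynomial_function f"
      using polynomial_function_compose[OF _ poly] by (auto simp: f_def o_def)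
    then have "odd (Brouwer_degree2 (n - 1) (sphere_map f))"
      using n nz odd_q[of "(_, 0)"] coord_subspace_full[where 'n='n]
      by (intro odd_degree_polynomial) (auto simp: f_def coord_sphere_def n_def)
    ultimately show ?thesis
      by simp
  qed
  ultimately show False
    by simp
qed

text \<open>
  If \<open>g\<close> had no zero, its norm would be bounded away from 0. A polynomial map that approximates \<open>g\<close>
  more closely than this bound, and hence also the odd part \<open>r\<close> of that polynomial map,
  would have no zero either.
\<close>

theorem Borsuk_Ulam:
  fixes g :: "(real ^ 'n) \<times> real \<Rightarrow> real ^ 'n"
  assumes cont: "continuous_on (sphere 0 1) g"
    and odd_g: "\<And>x. x \<in> sphere 0 1 \<Longrightarrow> g (- x) = - g x"
  shows "\<exists>x \<in> sphere 0 1. g x = 0"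
proof (rule ccontr)
  let ?S = "sphere 0 1 :: ((real ^ 'n) \<times> real) set"
  assume no_zero: "\<not> ?thesis"
  have "(0, 1) \<in> ?S"
    by (simp add: norm_Pair)
  then have "\<exists>z\<in>?S. \<forall>x\<in>?S. norm (g z) \<le> norm (g x)"
    using cont by (intro continuous_attains_inf compact_sphere continuous_on_norm) auto
  then obtain z where z: "z \<in> ?S" "\<And>x. x \<in> ?S \<Longrightarrow> norm (g z) \<le> norm (g x)"
    by blast
  then have "norm (g z) > 0"
    using no_zero by auto
  then obtain q where q: "polynomial_function q" "\<And>x. x \<in> ?S \<Longrightarrow> norm (g x - q x) < norm (g z)"
    using Stone_Weierstrass_polynomial_function[OF compact_sphere cont] by metis
  define r where "r = (\<lambda>x. (1 / 2) *\<^sub>R (q x - q (- x)))"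
  have "polynomial_function (\<lambda>x. q (- x))"
    using polynomial_function_compose[OF polynomial_function_minus[OF polynomial_function_id] q(1)]
    by (simp add: o_def)
  then have "polynomial_function r"
    unfolding r_def using q by (intro polynomial_function_cmul polynomial_function_diff)
  moreover have "r (- x) = - r x" for x
    by (simp add: r_def flip: scaleR_minus_right)
  ultimately obtain x where x: "x \<in> ?S" "r x = 0"
    using Borsuk_Ulam_polynomial by blast
  then have eq: "q (- x) = q x"
    by (simp add: r_def)
  have "norm (g x - q x) < norm (g z)" "norm (g (- x) - q (- x)) < norm (g z)"
    using x(1) q(2)[of x] q(2)[of "- x"] by auto
  then have "norm ((g x - q x) - (- g x - q x)) < 2 * norm (g z)"
    using odd_g[OF x(1)] eq norm_triangle_ineq4[of "g x - q x" "- g x - q x"] by simp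
  moreover have "(g x - q x) - (- g x - q x) = 2 *\<^sub>R g x"
    by (simp add: scaleR_2)
  ultimately show False
    using z(2)[OF x(1)] by simp
qed

section \<open>Oscillation on caps\<close>

text \<open>
  The value 0 on the empty set is the one that keeps the oscillation continuous when a cap shrinks to
  a point and then vanishes.
\<close>

definition spread :: "'a set \<Rightarrow> ('a \<Rightarrow> real) \<Rightarrow> real"
  where "spread S f = (if S = {} then 0 else max_over S f - min_over S f)"

lemma spread_attained:
  fixes S :: "'a::topological_space set"
  assumes "compact S" "S \<noteq> {}" "continuous_on S f"
  shows "\<exists>x\<in>S. \<exists>y\<in>S. spread S f = f x - f y"
  using max_over_attained(1)[OF assms] min_over_attained(1)[OF assms] assms(2)
  by (fastforce simp: spread_def)

lemma spread_upper:
  fixes S :: "'a::topological_space set"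
  assumes "compact S" "continuous_on S f" "x \<in> S" "y \<in> S"
  shows "f x - f y \<le> spread S f"
proof -
  have "S \<noteq> {}"
    using assms(3) by auto
  then show ?thesis
    using max_over_attained(2)[OF assms(1) _ assms(2) assms(3)]
      min_over_attained(2)[OF assms(1) _ assms(2) assms(4)]
    by (simp add: spread_def)
qed

lemma spread_nonneg:
  fixes S :: "'a::topological_space set"
  assumes "compact S" "continuous_on S f"
  shows "0 \<le> spread S f"
proof (cases "S = {}")
  case False
  then obtain x where "x \<in> S" by auto
  then show ?thesis
    using spread_upper[OF assms, of x x] by simp
qed (simp add: spread_def)

lemma spread_minus:
  fixes S :: "'a::topological_space set"
  assumes "compact S" "continuous_on S f"
  shows "spread S (\<lambda>x. - f x) = spread S f"
proof (cases "S = {}")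
  case False
  have *: "spread S (\<lambda>x. - g x) \<le> spread S g" if "continuous_on S g" for g
    using spread_attained[OF assms(1) False continuous_on_minus[OF that]] spread_upper[OF assms(1) that]
    by fastforce
  show ?thesis
    using *[OF assms(2)] *[OF continuous_on_minus[OF assms(2)]] by simp
qed (simp add: spread_def)

lemma halfspace_neg_eq: "halfspace_neg v = halfspace_pos (- v)"
  by (auto simp: halfspace_neg_def halfspace_pos_def)

lemma closed_halfspace_pos: "closed (halfspace_pos v)"
  unfolding halfspace_pos_def by (intro closed_Collect_le continuous_intros)

text \<open>
  If the cap did not reach beyond the hyperplane, the hyperplane would support \<open>A\<close>, and the cap
  would be the set of contact points, which is a singleton. Here \<open>v \<noteq> 0\<close> excludes that
  the half-space is given by \<open>0 \<ge> 0\<close>.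
\<close>

lemma cap_reaches_beyond_hyperplane:
  fixes A :: "(real ^ 'n) set"
  assumes rotund: "\<And>x H. x \<in> frontier A \<Longrightarrow> supporting_hyperplane A x H \<Longrightarrow> is_singleton (A \<inter> H)"
    and v: "v \<noteq> 0"
    and x: "x \<in> A \<inter> halfspace_pos v" and y: "y \<in> A \<inter> halfspace_pos v" and "x \<noteq> y"
  shows "\<exists>a\<in>A. fst v \<bullet> a > snd v"
proof (rule ccontr)
  assume "\<not> ?thesis"
  then have le: "fst v \<bullet> a \<le> snd v" if "a \<in> A" for a
    using that by force
  have eq: "fst v \<bullet> x = snd v" "fst v \<bullet> y = snd v"
    using x y le by (auto simp: halfspace_pos_def intro: antisym)
  have nz: "fst v \<noteq> 0"
    using eq(1) v by (auto simp: prod_eq_iff)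
  have "x \<notin> interior A"
  proof
    assume "x \<in> interior A"
    then obtain e where e: "e > 0" "cball x e \<subseteq> A"
      by (auto simp: mem_interior_cball)
    have "x + (e / norm (fst v)) *\<^sub>R fst v \<in> A"
      using e nz by (intro subsetD[OF e(2)]) (auto simp: dist_norm)
    from le[OF this] have "(e / norm (fst v)) * (fst v \<bullet> fst v) \<le> 0"
      using eq by (simp add: inner_add_right)
    moreover have "(e / norm (fst v)) * (fst v \<bullet> fst v) > 0"
      using e nz by simp
    ultimately show False
      by simp
  qed
  then have "x \<in> frontier A"
    using x closure_subset[of A] by (auto simp: frontier_def)
  moreover have "supporting_hyperplane A x {z. fst v \<bullet> z = snd v}"
    using nz eq le by (auto simp: supporting_hyperplane_def)
  ultimately have "is_singleton (A \<inter> {z. fst v \<bullet> z = snd v})"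
    by (rule rotund)
  then obtain z where "A \<inter> {z. fst v \<bullet> z = snd v} = {z}"
    by (auto simp: is_singleton_def)
  then have "x \<in> {z}" "y \<in> {z}"
    using x y eq by blast+
  then show False
    using \<open>x \<noteq> y\<close> by simp
qed

text \<open>
  Upper semicontinuity. For \<open>c > 0\<close> an oscillation of at least \<open>c\<close> is witnessed by two points of the
  cap, and the parameters \<open>v\<close> together with their witnesses form a compact set, of which the
  superlevel set is a projection.
\<close>

lemma closed_superlevel_spread_cap:
  fixes A :: "(real ^ 'n) set" and \<phi> :: "(real ^ 'n) \<times> real \<Rightarrow> real ^ 'n \<Rightarrow> real"
  assumes A: "compact A" and cont: "continuous_on UNIV (\<lambda>(v, x). \<phi> v x)"
  shows "closed {v \<in> sphere 0 1. c \<le> spread (A \<inter> halfspace_pos v) (\<phi> v)}"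
proof (cases "c > 0")
  case True
  let ?K = "(sphere 0 1 \<times> A \<times> A) \<inter>
    ({(v, x, y). snd v \<le> fst v \<bullet> x} \<inter> {(v, x, y). snd v \<le> fst v \<bullet> y} \<inter> {(v, x, y). c \<le> \<phi> v x - \<phi> v y})"
  have 1: "continuous_on UNIV (\<lambda>z :: ((real ^ 'n) \<times> real) \<times> (real ^ 'n) \<times> (real ^ 'n). \<phi> (fst z) (fst (snd z)))"
    using continuous_on_compose2[OF cont, of UNIV "\<lambda>z. (fst z, fst (snd z))"]
    by (simp add: continuous_on_Pair continuous_on_fst continuous_on_snd)
  have 2: "continuous_on UNIV (\<lambda>z :: ((real ^ 'n) \<times> real) \<times> (real ^ 'n) \<times> (real ^ 'n). \<phi> (fst z) (snd (snd z)))"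
    using continuous_on_compose2[OF cont, of UNIV "\<lambda>z. (fst z, snd (snd z))"]
    by (simp add: continuous_on_Pair continuous_on_fst continuous_on_snd)
  have "compact ?K"
    unfolding case_prod_unfold
    by (intro compact_Int_closed compact_Times compact_sphere A closed_Int closed_Collect_le
        continuous_intros 1 2)
  then have "closed (fst ` ?K)"
    by (intro compact_imp_closed compact_continuous_image continuous_intros)
  moreover have "{v \<in> sphere 0 1. c \<le> spread (A \<inter> halfspace_pos v) (\<phi> v)} = fst ` ?K"
  proof (intro equalityI subsetI)
    fix v assume v: "v \<in> {v \<in> sphere 0 1. c \<le> spread (A \<inter> halfspace_pos v) (\<phi> v)}"
    have "continuous_on (A \<inter> halfspace_pos v) (\<phi> v)"
      using continuous_on_compose2[OF cont, of _ "\<lambda>x. (v, x)"] by (auto simp: continuous_on_Pair)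
    moreover have "A \<inter> halfspace_pos v \<noteq> {}"
      using v True by (auto simp: spread_def)
    ultimately obtain x y where "x \<in> A \<inter> halfspace_pos v" "y \<in> A \<inter> halfspace_pos v"
        "spread (A \<inter> halfspace_pos v) (\<phi> v) = \<phi> v x - \<phi> v y"
      using spread_attained compact_Int_closed[OF A closed_halfspace_pos] by metis
    then show "v \<in> fst ` ?K"
      using v by (intro image_eqI[of _ _ "(v, x, y)"]) (auto simp: halfspace_pos_def)
  next
    fix v assume "v \<in> fst ` ?K"
    then obtain x y where v: "v \<in> sphere 0 1" "x \<in> A \<inter> halfspace_pos v" "y \<in> A \<inter> halfspace_pos v"
      "c \<le> \<phi> v x - \<phi> v y"
      by (auto simp: halfspace_pos_def)
    have "continuous_on (A \<inter> halfspace_pos v) (\<phi> v)"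
      using continuous_on_compose2[OF cont, of _ "\<lambda>x. (v, x)"] by (auto simp: continuous_on_Pair)
    then have "\<phi> v x - \<phi> v y \<le> spread (A \<inter> halfspace_pos v) (\<phi> v)"
      using v by (intro spread_upper compact_Int_closed[OF A closed_halfspace_pos])
    then show "v \<in> {v \<in> sphere 0 1. c \<le> spread (A \<inter> halfspace_pos v) (\<phi> v)}"
      using v by auto
  qed
  ultimately show ?thesis
    by simp
next
  case False
  have "continuous_on (A \<inter> halfspace_pos v) (\<phi> v)" for v
    using continuous_on_compose2[OF cont, of _ "\<lambda>x. (v, x)"] by (auto simp: continuous_on_Pair)
  then have "0 \<le> spread (A \<inter> halfspace_pos v) (\<phi> v)" for v
    by (intro spread_nonneg compact_Int_closed[OF A closed_halfspace_pos])
  then have "{v \<in> sphere 0 1. c \<le> spread (A \<inter> halfspace_pos v) (\<phi> v)} = sphere 0 1"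
    using False by (auto intro: order_trans[of _ 0])
  then show ?thesis
    by simp
qed

text \<open>
  Lower semicontinuity. If the oscillation is positive, its two extremal points are distinct, so
  the cap has a point \<open>a\<close> strictly inside the half-space. Moving the extremal points slightly towards
  \<open>a\<close> costs little oscillation, and the moved points stay in the caps of all nearby half-spaces.
\<close>

lemma eventually_spread_cap_greater:
  fixes A :: "(real ^ 'n) set" and \<phi> :: "(real ^ 'n) \<times> real \<Rightarrow> real ^ 'n \<Rightarrow> real"
  assumes A: "compact A" "convex A"
    and rotund: "\<And>x H. x \<in> frontier A \<Longrightarrow> supporting_hyperplane A x H \<Longrightarrow> is_singleton (A \<inter> H)"
    and cont: "continuous_on UNIV (\<lambda>(v, x). \<phi> v x)"
    and v: "v \<noteq> 0" and c: "c < spread (A \<inter> halfspace_pos v) (\<phi> v)"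
  shows "eventually (\<lambda>w. c < spread (A \<inter> halfspace_pos w) (\<phi> w)) (at v)"
proof -
  have cap_compact: "compact (A \<inter> halfspace_pos w)" for w
    by (rule compact_Int_closed[OF A(1) closed_halfspace_pos])
  have cont1: "continuous_on S (\<phi> w)" for S w
    using continuous_on_compose2[OF cont, of _ "\<lambda>x. (w, x)"] by (auto simp: continuous_on_Pair)
  have cont2: "((\<lambda>w. \<phi> w x) \<longlongrightarrow> \<phi> v x) (at v)" for x
  proof -
    have "continuous_on UNIV (\<lambda>w. \<phi> w x)"
      using continuous_on_compose2[OF cont, of UNIV "\<lambda>w. (w, x)"]
      by (auto simp: continuous_on_Pair)
    then show ?thesis
      by (metis UNIV_I continuous_on_def)
  qed
  have nonneg: "0 \<le> spread (A \<inter> halfspace_pos w) (\<phi> w)" for w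
    by (intro spread_nonneg cap_compact cont1)
  show ?thesis
  proof (cases "c < 0")
    case True
    then show ?thesis
      using nonneg by (intro always_eventually allI) (rule less_le_trans)
  next
    case False
    then have "A \<inter> halfspace_pos v \<noteq> {}"
      using c by (auto simp: spread_def)
    then obtain x y where xy: "x \<in> A \<inter> halfspace_pos v" "y \<in> A \<inter> halfspace_pos v"
      and eq: "spread (A \<inter> halfspace_pos v) (\<phi> v) = \<phi> v x - \<phi> v y"
      using spread_attained[OF cap_compact _ cont1] by metis
    then have "x \<noteq> y"
      using c False by auto
    then have "\<exists>a\<in>A. fst v \<bullet> a > snd v"
      using rotund by (intro cap_reaches_beyond_hyperplane[OF _ v xy])
    then obtain a where a: "a \<in> A" "fst v \<bullet> a > snd v"
      by blast
    define shift where "shift = (\<lambda>z s. (1 - s) *\<^sub>R z + s *\<^sub>R a)"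
    have lim: "((\<lambda>s. \<phi> v (shift z s)) \<longlongrightarrow> \<phi> v z) (at_right 0)" for z
    proof -
      have "(shift z \<longlongrightarrow> shift z 0) (at_right 0)"
        unfolding shift_def by (intro tendsto_intros)
      then show ?thesis
        using continuous_on_tendsto_compose[OF cont1[of UNIV v]] by (fastforce simp: shift_def)
    qed
    have "((\<lambda>s. \<phi> v (shift x s) - \<phi> v (shift y s)) \<longlongrightarrow> \<phi> v x - \<phi> v y) (at_right 0)"
      by (intro tendsto_diff lim)
    then have "eventually (\<lambda>s. c < \<phi> v (shift x s) - \<phi> v (shift y s)) (at_right 0)"
      using c eq by (auto intro: order_tendstoD)
    moreover have "eventually (\<lambda>s::real. s \<in> {0<..<1}) (at_right 0)"
      by (rule eventually_at_right_real) simp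
    ultimately have "eventually (\<lambda>s. c < \<phi> v (shift x s) - \<phi> v (shift y s) \<and> s \<in> {0<..<1}) (at_right 0)"
      by (rule eventually_conj)
    then obtain s where s: "c < \<phi> v (shift x s) - \<phi> v (shift y s)" "0 < s" "s < 1"
      using eventually_happens trivial_limit_at_right_real by fastforce
    have shift_in: "shift z s \<in> A" if "z \<in> A" for z
      unfolding shift_def using that s a(1) A(2) by (intro convexD) auto
    have beyond: "fst v \<bullet> shift z s > snd v" if "z \<in> A \<inter> halfspace_pos v" for z
    proof -
      have "(1 - s) * snd v \<le> (1 - s) * (fst v \<bullet> z)" "s * snd v < s * (fst v \<bullet> a)"
        using that s a by (auto simp: halfspace_pos_def)
      then show ?thesis
        by (simp add: shift_def inner_add_right algebra_simps)
    qed
    have stays: "eventually (\<lambda>w. shift z s \<in> A \<inter> halfspace_pos w) (at v)" if "z \<in> A \<inter> halfspace_pos v" for z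
    proof -
      have "((\<lambda>w. fst w \<bullet> shift z s - snd w) \<longlongrightarrow> fst v \<bullet> shift z s - snd v) (at v)"
        by (intro tendsto_intros)
      then have "eventually (\<lambda>w. 0 < fst w \<bullet> shift z s - snd w) (at v)"
        using beyond[OF that] by (intro order_tendstoD(1)) auto
      then show ?thesis
        using shift_in that by (auto elim!: eventually_mono simp: halfspace_pos_def)
    qed
    have "((\<lambda>w. \<phi> w (shift x s) - \<phi> w (shift y s)) \<longlongrightarrow> \<phi> v (shift x s) - \<phi> v (shift y s)) (at v)"
      by (intro tendsto_diff cont2)
    then have "eventually (\<lambda>w. c < \<phi> w (shift x s) - \<phi> w (shift y s)) (at v)"
      using s(1) by (rule order_tendstoD)
    then show ?thesis
      using stays[OF xy(1)] stays[OF xy(2)]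
    proof eventually_elim
      case (elim w)
      then show ?case
        using spread_upper[OF cap_compact cont1, of "shift x s" w "shift y s" w] by linarith
    qed
  qed
qed

lemma continuous_on_spread_cap:
  fixes A :: "(real ^ 'n) set" and \<phi> :: "(real ^ 'n) \<times> real \<Rightarrow> real ^ 'n \<Rightarrow> real"
  assumes A: "compact A" "convex A"
    and rotund: "\<And>x H. x \<in> frontier A \<Longrightarrow> supporting_hyperplane A x H \<Longrightarrow> is_singleton (A \<inter> H)"
    and cont: "continuous_on UNIV (\<lambda>(v, x). \<phi> v x)"
  shows "continuous_on (sphere 0 1) (\<lambda>v. spread (A \<inter> halfspace_pos v) (\<phi> v))"
  unfolding continuous_on_def
proof (intro ballI order_tendstoI)
  let ?W = "\<lambda>v. spread (A \<inter> halfspace_pos v) (\<phi> v)"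
  fix v :: "(real ^ 'n) \<times> real" and c
  assume v: "v \<in> sphere 0 1"
  show "eventually (\<lambda>w. c < ?W w) (at v within sphere 0 1)" if "c < ?W v"
  proof -
    have "v \<noteq> 0"
      using v by auto
    then have "eventually (\<lambda>w. c < ?W w) (at v)"
      using rotund that by (intro eventually_spread_cap_greater A cont) auto
    then show ?thesis
      by (rule filter_leD[OF at_le[OF subset_UNIV]])
  qed
  show "eventually (\<lambda>w. ?W w < c) (at v within sphere 0 1)" if "?W v < c"
    unfolding eventually_at_topological
    using closed_superlevel_spread_cap[OF A(1) cont, of c] that
    by (intro exI[of _ "- {v \<in> sphere 0 1. c \<le> ?W v}"]) (auto simp: open_Compl)
qed

text \<open>
  Since \<open>Q\<close> is invertible, \<open>u = Q *v z\<close> for some \<open>z\<close>, and the function increases when \<open>x\<close> moves in the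
  direction \<open>z\<close> from an interior point.
\<close>

lemma spread_pos:
  fixes A :: "(real ^ 'n) set" and Q :: "real ^ 'n ^ 'n"
  assumes A: "compact A" "interior A \<noteq> {}" and Q: "invertible Q" and u: "u \<noteq> 0"
  shows "0 < spread A (\<lambda>x. u \<bullet> (Q *v x))"
proof -
  obtain a e where e: "e > 0" "cball a e \<subseteq> A"
    using A(2) by (metis equals0I mem_interior_cball)
  obtain z where z: "Q *v z = u"
    using Q by (metis invertible_def matrix_vector_mul_assoc matrix_vector_mul_lid)
  have nz: "z \<noteq> 0"
    using z u by auto
  define d where "d = e / norm z"
  have d: "d > 0"
    using e nz by (simp add: d_def)
  have in_A: "a + d *\<^sub>R z \<in> A" "a \<in> A"
    using e nz by (auto intro!: subsetD[OF e(2)] simp: d_def dist_norm)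
  have "u \<bullet> (Q *v (a + d *\<^sub>R z)) - u \<bullet> (Q *v a) = d * (u \<bullet> u)"
    using z by (simp add: matrix_vector_right_distrib matrix_vector_mult_scaleR inner_add_right)
  moreover have "d * (u \<bullet> u) > 0"
    using d u by simp
  moreover have "continuous_on A (\<lambda>x. u \<bullet> (Q *v x))"
    by (intro continuous_intros linear_continuous_on matrix_vector_mul_bounded_linear)
  ultimately show ?thesis
    using spread_upper[OF A(1) _ in_A, of "\<lambda>x. u \<bullet> (Q *v x)"] by simp
qed

section \<open>Equal oscillations on both sides of a hyperplane\<close>

theorem theorem3p2:
  fixes A :: "'n::finite \<Rightarrow> (real ^ 'n) set"
    and Q :: "'n \<Rightarrow> real ^ 'n ^ 'n"
    and f :: "'n \<Rightarrow> real ^ 'n \<Rightarrow> (real ^ 'n) \<times> real \<Rightarrow> real"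
  assumes "\<And>i. compact (A i)"
    and "\<And>i. convex (A i)"
    and "\<And>i. interior (A i) \<noteq> {}"
    and "\<And>i x H. x \<in> frontier (A i) \<Longrightarrow> supporting_hyperplane (A i) x H \<Longrightarrow> is_singleton (A i \<inter> H)"
    and "\<And>i. invertible (Q i)"
    and "\<And>i x u. f i x u = fst u \<bullet> (Q i *v x)"
  shows "\<exists>u \<in> sphere (0 :: (real ^ 'n) \<times> real) 1. \<forall>i.
           A i \<inter> halfspace_pos u \<noteq> {} \<and> A i \<inter> halfspace_neg u \<noteq> {} \<and>
           max_over (A i \<inter> halfspace_pos u) (\<lambda>x. f i x u) - min_over (A i \<inter> halfspace_pos u) (\<lambda>x. f i x u)
         = max_over (A i \<inter> halfspace_neg u) (\<lambda>x. f i x u) - min_over (A i \<inter> halfspace_neg u) (\<lambda>x. f i x u)"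
proof -
  define \<phi> where "\<phi> = (\<lambda>i u x. f i x u)"
  have \<phi>: "\<phi> i u x = fst u \<bullet> (Q i *v x)" for i u x
    by (simp add: \<phi>_def assms(6))
  have cont_\<phi>: "continuous_on UNIV (\<lambda>(u, x). \<phi> i u x)" for i
    unfolding \<phi> case_prod_unfold
    by (intro continuous_intros bounded_linear.continuous_on[OF matrix_vector_mul_bounded_linear])
  have cont_\<phi>': "continuous_on S (\<phi> i u)" for S i u
    unfolding \<phi> by (intro continuous_intros linear_continuous_on matrix_vector_mul_bounded_linear)
  define W where "W = (\<lambda>i u. spread (A i \<inter> halfspace_pos u) (\<phi> i u))"
  have cap_compact: "compact (A i \<inter> halfspace_pos u)" for i u
    by (rule compact_Int_closed[OF assms(1) closed_halfspace_pos])
  have W_nonneg: "0 \<le> W i u" for i u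
    unfolding W_def by (intro spread_nonneg cap_compact cont_\<phi>')
  have W_minus: "W i (- u) = spread (A i \<inter> halfspace_neg u) (\<phi> i u)" for i u
  proof -
    have "\<phi> i (- u) = (\<lambda>x. - \<phi> i u x)"
      by (simp add: \<phi> fun_eq_iff)
    then show ?thesis
      using spread_minus[OF cap_compact cont_\<phi>', of i "- u" i u]
      by (simp add: W_def halfspace_neg_eq)
  qed
  have cont_W: "continuous_on (sphere 0 1) (W i)" for i
    unfolding W_def using assms(4) by (intro continuous_on_spread_cap assms(1,2) cont_\<phi>) auto
  have cont_W_minus: "continuous_on (sphere 0 1) (\<lambda>u. W i (- u))" for i
    by (rule continuous_on_compose2[OF cont_W]) (auto intro: continuous_intros simp: norm_Pair)

  have "bounded (\<Union>i. A i)"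
    using assms(1) by (intro bounded_UN ballI compact_imp_bounded) auto
  then obtain R where R: "\<And>i x. x \<in> A i \<Longrightarrow> norm x \<le> R"
    by (auto simp: bounded_iff)
  (* Where the last term is not 0, all of the A i lie on one side of the hyperplane. *)
  define g where "g = (\<lambda>u. \<chi> i. W i u - W i (- u) - snd u * max 0 (\<bar>snd u\<bar> - R * norm (fst u)))"
  have "continuous_on (sphere 0 1) g"
    unfolding g_def by (intro continuous_intros cont_W cont_W_minus)
  moreover have odd_g: "g (- u) = - g u" for u
    by (simp add: g_def vec_eq_iff)
  ultimately obtain u where u: "u \<in> sphere 0 1" "g u = 0"
    using Borsuk_Ulam by blast

  have not_high: "\<not> R * norm (fst v) < snd v" if "g v = 0" for v
  proof
    fix i
    assume high: "R * norm (fst v) < snd v"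
    have "A i \<inter> halfspace_pos v = {}"
    proof -
      have "fst v \<bullet> x < snd v" if "x \<in> A i" for x
      proof -
        have "fst v \<bullet> x \<le> norm (fst v) * norm x"
          by (rule norm_cauchy_schwarz)
        also have "\<dots> \<le> norm (fst v) * R"
          using R[OF that] by (intro mult_left_mono) auto
        finally show ?thesis
          using high by (simp add: mult.commute)
      qed
      then show ?thesis
        by (force simp: halfspace_pos_def)
    qed
    then have "W i v = 0"
      by (simp add: W_def spread_def)
    moreover have "0 \<le> R"
      using R assms(3)[of i] interior_subset[of "A i"] norm_ge_zero order_trans by blast
    then have "0 < snd v * max 0 (\<bar>snd v\<bar> - R * norm (fst v))"
      using high by (intro mult_pos_pos) (auto simp: zero_less_mult_iff intro: le_less_trans[of _ "R * norm (fst v)"])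
    ultimately have "g v $ i < 0"
      using W_nonneg[of i "- v"] by (simp add: g_def)
    then show False
      using that by simp
  qed
  have low: "\<bar>snd u\<bar> \<le> R * norm (fst u)"
    using not_high[OF u(2)] not_high[of "- u"] odd_g[of u] u(2) by auto
  have nz: "fst u \<noteq> 0"
  proof
    assume "fst u = 0"
    with low have "u = 0"
      by (simp add: prod_eq_iff)
    with u(1) show False
      by simp
  qed
  have W_eq: "W i u = W i (- u)" for i
    using arg_cong[OF u(2), of "\<lambda>v. v $ i"] low by (simp add: g_def)

  have pos_nonempty: "A i \<inter> halfspace_pos v \<noteq> {}" if "fst v \<noteq> 0" "W i v = W i (- v)" for i v
  proof
    assume empty: "A i \<inter> halfspace_pos v = {}"
    then have "A i \<inter> halfspace_neg v = A i"
      by (force simp: halfspace_pos_def halfspace_neg_def)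
    then have "W i (- v) > 0"
      using spread_pos[OF assms(1) assms(3) assms(5) that(1)] by (simp add: W_minus \<phi>[abs_def])
    moreover have "W i v = 0"
      using empty by (simp add: W_def spread_def)
    ultimately show False
      using that(2) by simp
  qed
  have "A i \<inter> halfspace_pos u \<noteq> {}" "A i \<inter> halfspace_neg u \<noteq> {}" for i
    using pos_nonempty[of u i] pos_nonempty[of "- u" i] nz W_eq[of i] by (auto simp: halfspace_neg_eq)
  then show ?thesis
    using W_eq u(1) unfolding W_minus
    by (intro bexI[of _ u]) (simp_all add: W_def spread_def \<phi>_def)
qed

end
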